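(* Let $f:\mathbb{R}^n\times\mathbb{R}^m\to\mathbb{R}^n$ be a continuous mapping with $f(0,0)=0$. Suppose that there exists a continuous function $k:\mathbb{R}^n\to\mathbb{R}^m$ with $k(0)=0$ such that $0\in\mathbb{R}^n$ is globally asymptotically stable for the system $x(t+1)=f(x(t),k(x(t)))$. Let a continuous, positive definite and radially unbounded function $V:\mathbb{R}^n\to\mathbb{R}_+$ and a constant $\lambda\in[0,1)$ be such that $$V(f(x,k(x)))\le \lambda V(x)\quad\text{for all } x\in\mathbb{R}^n .$$ Then the following hold: (i) $0\in\mathbb{R}^n\times\mathbb{R}^m$ is globally asymptotically stable for the closed-loop system $$x(t+1)=f(x(t),y_1(t)),\qquad y_1(t+1)=k(f(x(t),y_1(t))),\qquad (x(t),y_1(t))\in\mathbb{R}^n\times\mathbb{R}^m .$$ (ii) For every $a\in K_\infty$ and for every constant $c>\frac{1}{1-\lambda}$, the function $\overline V:\mathbb{R}^n\times\mathbb{R}^m\to\mathbb{R}_+$ defined by $$\overline V(x,y_1):=V(x)+c\,V(f(x,y_1))+a\big(|y_1-k(x)|\big)$$ is a continuous, positive definite and radially unbounded function that satisfies $$\overline V\big(f(x,y_1),k(f(x,y_1))\big)\le(\lambda+c^{-1})\,\overline V(x,y_1)\quad\text{for all }(x,y_1)\in\mathbb{R}^n\times\mathbb{R}^m .$$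
   Context: $\mathbb{R}_+=[0,\infty)$ and $|\cdot|$ is the Euclidean norm. $K_\infty$ is the class of continuous, strictly increasing, unbounded functions $a:\mathbb{R}_+\to\mathbb{R}_+$ with $a(0)=0$. A function $W:\mathbb{R}^N\to\mathbb{R}_+$ is positive definite if $W(0)=0$ and $W(z)>0$ for $z\neq0$; it is radially unbounded if the sets $\{z: W(z)\le M\}$ are bounded for all $M\ge0$. For a discrete-time system $z(t+1)=g(z(t))$ with $g(0)=0$, $t=0,1,2,\dots$, the equilibrium $0$ is globally asymptotically stable in the standard sense: it is Lyapunov stable and every solution converges to $0$ as $t\to\infty$. *)

theory Defs
  imports "HOL-Analysis.Analysis"
begin

text \<open>Functions on \<open>[0,\<infinity>)\<close> are total functions on the reals of which only the
  values on \<open>{0..}\<close> matter.\<close>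

definition K_infinity :: "(real \<Rightarrow> real) set" where
  "K_infinity = {a. a ` {0..} \<subseteq> {0..} \<and> continuous_on {0..} a \<and> strict_mono_on {0..} a
      \<and> \<not> bounded (a ` {0..}) \<and> a 0 = 0}"

text \<open>The first conjunct renders the codomain \<open>[0,\<infinity>)\<close>.\<close>

definition positive_definite :: "('a::real_normed_vector \<Rightarrow> real) \<Rightarrow> bool" where
  "positive_definite W \<longleftrightarrow> (\<forall>z. 0 \<le> W z) \<and> W 0 = 0 \<and> (\<forall>z. z \<noteq> 0 \<longrightarrow> 0 < W z)"

definition radially_unbounded :: "('a::real_normed_vector \<Rightarrow> real) \<Rightarrow> bool" where
  "radially_unbounded W \<longleftrightarrow> (\<forall>M\<ge>0. bounded {z. W z \<le> M})"

definition solution :: "('a \<Rightarrow> 'a) \<Rightarrow> (nat \<Rightarrow> 'a) \<Rightarrow> bool" where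
  "solution g z \<longleftrightarrow> (\<forall>t. z (Suc t) = g (z t))"

definition lyapunov_stable :: "('a::real_normed_vector \<Rightarrow> 'a) \<Rightarrow> bool" where
  "lyapunov_stable g \<longleftrightarrow>
     (\<forall>\<epsilon>>0. \<exists>\<delta>>0. \<forall>z. solution g z \<and> norm (z 0) < \<delta> \<longrightarrow> (\<forall>t. norm (z t) < \<epsilon>))"

definition globally_asymptotically_stable :: "('a::real_normed_vector \<Rightarrow> 'a) \<Rightarrow> bool" where
  "globally_asymptotically_stable g \<longleftrightarrow>
     g 0 = 0 \<and> lyapunov_stable g \<and> (\<forall>z. solution g z \<longrightarrow> z \<longlonglongrightarrow> 0)"

text \<open>The norm of the product type \<open>'x \<times> 'y\<close> is \<open>sqrt ((norm x)\<^sup>2 + (norm y)\<^sup>2)\<close>, so on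
  \<open>(real ^ 'n) \<times> (real ^ 'm)\<close> it is the Euclidean norm of the concatenated vector.\<close>

definition closed_loop :: "('x \<times> 'y \<Rightarrow> 'x) \<Rightarrow> ('x \<Rightarrow> 'y) \<Rightarrow> 'x \<times> 'y \<Rightarrow> 'x \<times> 'y" where
  "closed_loop f k = (\<lambda>(x, y). (f (x, y), k (f (x, y))))"

definition V_bar :: "('x \<times> 'y \<Rightarrow> 'x) \<Rightarrow> ('x \<Rightarrow> 'y::real_normed_vector) \<Rightarrow> ('x \<Rightarrow> real)
    \<Rightarrow> (real \<Rightarrow> real) \<Rightarrow> real \<Rightarrow> 'x \<times> 'y \<Rightarrow> real" where
  "V_bar f k V a c = (\<lambda>(x, y). V x + c * V (f (x, y)) + a (norm (y - k x)))"

end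

theory Submission
  imports Defs
begin

text \<open>Write \<open>g x = f (x, k x)\<close>. After one step the closed loop lives on the graph of \<open>k\<close>, and on
  that graph it is a copy of the system \<open>g\<close>: the first component of a closed-loop trajectory,
  read from time 1 on, is a trajectory of \<open>g\<close>, and the second component is its image under \<open>k\<close>.
  Hence convergence carries over because \<open>k\<close> is continuous at 0, and stability carries over because
  the first step is continuous at 0, too.

  The same observation explains why \<open>V_bar\<close> decays. At the successor state the term with \<open>a\<close> vanishes and what
  remains is \<open>V (f (x, y)) + c * V (g (f (x, y))) \<le> (1 + c * lam) * V (f (x, y))\<close>, which is
  \<open>lam + 1 / c\<close> times the middle term of \<open>V_bar\<close> at the present state; \<open>c > 1 / (1 - lam)\<close>
  says that this factor is less than 1. The outer terms of \<open>V_bar\<close>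
  make it positive definite and radially unbounded: a bound on \<open>V x\<close> confines \<open>x\<close>, thus \<open>k x\<close>, to a
  compact set, and a bound on \<open>a (norm (y - k x))\<close> then confines \<open>y\<close>.\<close>

lemma solution_closed_loop_graph:
  assumes "solution (closed_loop f k) z"
  shows "z (Suc t) = (f (z t), k (f (z t)))"
  using assms by (cases "z t") (simp add: solution_def closed_loop_def)

lemma solution_closed_loop_fst:
  assumes "solution (closed_loop f k) z"
  shows "solution (\<lambda>x. f (x, k x)) (\<lambda>t. fst (z (Suc t)))"
  by (simp add: solution_def solution_closed_loop_graph[OF assms])

text \<open>Three radii are chosen backwards in time: \<open>d1\<close> makes \<open>k\<close> small, \<open>d2\<close> keeps trajectories of the
  system on the graph within \<open>d1\<close>, and \<open>d3\<close> brings the first step within \<open>d2\<close>.\<close>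

lemma lyapunov_stable_closed_loop:
  fixes f :: "'x::real_normed_vector \<times> 'y::real_normed_vector \<Rightarrow> 'x" and k :: "'x \<Rightarrow> 'y"
  assumes f: "isCont f 0" "f 0 = 0" and k: "isCont k 0" "k 0 = 0"
    and stable: "lyapunov_stable (\<lambda>x. f (x, k x))"
  shows "lyapunov_stable (closed_loop f k)"
  unfolding lyapunov_stable_def
proof (intro allI impI)
  fix e :: real assume "e > 0"
  then obtain d1 where d1: "d1 > 0" "\<And>x. norm x < d1 \<Longrightarrow> norm (k x) < e / 2"
    using k(1)[unfolded continuous_at_eps_delta, rule_format, of "e / 2"] k(2)
    by (auto simp: dist_norm)
  obtain d2 where d2: "d2 > 0"
    "\<And>x t. solution (\<lambda>x. f (x, k x)) x \<Longrightarrow> norm (x 0) < d2 \<Longrightarrow> norm (x t) < min d1 (e / 2)"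
    using stable[unfolded lyapunov_stable_def, rule_format, of "min d1 (e / 2)"] d1(1) \<open>e > 0\<close>
    by auto
  obtain d3 where d3: "d3 > 0" "\<And>z. norm z < d3 \<Longrightarrow> norm (f z) < d2"
    using f(1)[unfolded continuous_at_eps_delta, rule_format, of d2] f(2) d2(1)
    by (auto simp: dist_norm)
  show "\<exists>d>0. \<forall>z. solution (closed_loop f k) z \<and> norm (z 0) < d \<longrightarrow> (\<forall>t. norm (z t) < e)"
  proof (intro exI[of _ "min d3 e"] conjI allI impI)
    show "min d3 e > 0" using d3 \<open>e > 0\<close> by simp
    fix z t assume "solution (closed_loop f k) z \<and> norm (z 0) < min d3 e"
    then have z: "solution (closed_loop f k) z" "norm (z 0) < d3" "norm (z 0) < e"
      by simp_all
    show "norm (z t) < e"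
    proof (cases t)
      case 0
      then show ?thesis using z by simp
    next
      case (Suc s)
      define x where "x = fst (z (Suc s))"
      have "norm (fst (z (Suc 0))) < d2"
        using d3(2)[OF z(2)] by (simp add: solution_closed_loop_graph[OF z(1)])
      then have x: "norm x < d1" "norm x < e / 2"
        using d2(2)[OF solution_closed_loop_fst[OF z(1)], of s] by (simp_all add: x_def)
      have "z t = (x, k x)"
        by (simp add: Suc x_def solution_closed_loop_graph[OF z(1)])
      then have "norm (z t) \<le> norm x + norm (k x)"
        by (simp add: norm_Pair_le)
      then show ?thesis using x(2) d1(2)[OF x(1)] by linarith
    qed
  qed
qed

lemma closed_loop_tendsto_0:
  fixes f :: "'x::real_normed_vector \<times> 'y::real_normed_vector \<Rightarrow> 'x" and k :: "'x \<Rightarrow> 'y"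
  assumes k: "isCont k 0" "k 0 = 0"
    and attractive: "\<And>x. solution (\<lambda>x. f (x, k x)) x \<Longrightarrow> x \<longlonglongrightarrow> 0"
    and z: "solution (closed_loop f k) z"
  shows "z \<longlonglongrightarrow> 0"
proof -
  define x where "x = (\<lambda>t. fst (z (Suc t)))"
  have x: "x \<longlonglongrightarrow> 0"
    using attractive[OF solution_closed_loop_fst[OF z]] by (simp add: x_def)
  have "(\<lambda>t. (x t, k (x t))) \<longlonglongrightarrow> (0, k 0)"
    by (intro tendsto_Pair x isCont_tendsto_compose[OF k(1)])
  moreover have "z (Suc t) = (x t, k (x t))" for t
    by (simp add: x_def solution_closed_loop_graph[OF z])
  ultimately have "(\<lambda>t. z (Suc t)) \<longlonglongrightarrow> 0"
    using k(2) by (simp add: zero_prod_def)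
  then show ?thesis by (rule LIMSEQ_imp_Suc)
qed

theorem globally_asymptotically_stable_closed_loop:
  fixes f :: "'x::real_normed_vector \<times> 'y::real_normed_vector \<Rightarrow> 'x" and k :: "'x \<Rightarrow> 'y"
  assumes "isCont f 0" "f 0 = 0" "isCont k 0" "k 0 = 0"
    and "globally_asymptotically_stable (\<lambda>x. f (x, k x))"
  shows "globally_asymptotically_stable (closed_loop f k)"
  unfolding globally_asymptotically_stable_def
proof (intro conjI allI impI)
  show "closed_loop f k 0 = 0"
    using assms(2,4) by (simp add: closed_loop_def zero_prod_def)
  show "lyapunov_stable (closed_loop f k)"
    using assms by (intro lyapunov_stable_closed_loop)
      (simp_all add: globally_asymptotically_stable_def)
  show "z \<longlonglongrightarrow> 0" if "solution (closed_loop f k) z" for z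
    using assms(5) by (intro closed_loop_tendsto_0[OF assms(3,4) _ that])
      (simp add: globally_asymptotically_stable_def)
qed

lemma K_infinityD:
  assumes "a \<in> K_infinity"
  shows "a ` {0..} \<subseteq> {0..}" "continuous_on {0..} a" "strict_mono_on {0..} a"
    "\<not> bounded (a ` {0..})" "a 0 = 0"
  using assms unfolding K_infinity_def by blast+

lemma K_infinity_nonneg:
  assumes "a \<in> K_infinity" "0 \<le> r"
  shows "0 \<le> a r"
  using K_infinityD(1)[OF assms(1)] assms(2) by (metis atLeast_iff image_subset_iff)

lemma K_infinity_pos:
  assumes "a \<in> K_infinity" "0 < r"
  shows "0 < a r"
  using strict_mono_onD[OF K_infinityD(3)[OF assms(1)], of 0 r] K_infinityD(5)[OF assms(1)] assms(2)
  by simp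

lemma K_infinity_sublevel_bounded:
  assumes a: "a \<in> K_infinity"
  obtains R where "\<And>r. 0 \<le> r \<Longrightarrow> a r \<le> M \<Longrightarrow> r \<le> R"
proof -
  have "\<not> (\<forall>v\<in>a ` {0..}. norm v \<le> M)"
    using K_infinityD(4)[OF a] unfolding bounded_iff by blast
  then obtain R where "0 \<le> R" "\<not> norm (a R) \<le> M"
    by (metis atLeast_iff imageE)
  then have R: "0 \<le> R" "M < a R"
    using K_infinity_nonneg[OF a, of R] by simp_all
  have "r \<le> R" if "0 \<le> r" "a r \<le> M" for r
  proof (rule ccontr)
    assume "\<not> r \<le> R"
    then have "a R < a r"
      using R(1) that(1) by (intro strict_mono_onD[OF K_infinityD(3)[OF a]]) simp_all
    then show False using R(2) that(2) by linarith
  qed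
  then show thesis using that by blast
qed

lemma continuous_on_V_bar:
  fixes f :: "'x::real_normed_vector \<times> 'y::real_normed_vector \<Rightarrow> 'x" and k :: "'x \<Rightarrow> 'y"
  assumes f: "continuous_on UNIV f" and k: "continuous_on UNIV k"
    and V: "continuous_on UNIV V" and a: "a \<in> K_infinity"
  shows "continuous_on UNIV (V_bar f k V a c)"
proof -
  have "continuous_on UNIV (\<lambda>z. a (norm (snd z - k (fst z))))"
    by (intro continuous_on_compose2[OF K_infinityD(2)[OF a]] continuous_on_compose2[OF k]
        continuous_intros) auto
  moreover have "continuous_on UNIV (\<lambda>z. V (f z))"
    by (intro continuous_on_compose2[OF V] f) simp
  moreover have "continuous_on UNIV (\<lambda>z. V (fst z))"
    by (intro continuous_on_compose2[OF V] continuous_intros) simp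
  ultimately show ?thesis
    unfolding V_bar_def case_prod_unfold by (intro continuous_intros) simp_all
qed

lemma positive_definite_V_bar:
  fixes f :: "'x::real_normed_vector \<times> 'y::real_normed_vector \<Rightarrow> 'x" and k :: "'x \<Rightarrow> 'y"
  assumes f0: "f 0 = 0" and k0: "k 0 = 0" and V: "positive_definite V"
    and a: "a \<in> K_infinity" and c: "0 \<le> c"
  shows "positive_definite (V_bar f k V a c)"
proof -
  have V0: "V 0 = 0" and Vpos: "x \<noteq> 0 \<Longrightarrow> 0 < V x" and Vnn: "0 \<le> V x" for x
    using V by (auto simp: positive_definite_def)
  have nn: "0 \<le> c * V (f z)" "0 \<le> a (norm v)" for z and v :: 'y
    using c Vnn K_infinity_nonneg[OF a] by simp_all
  have pos: "0 < V_bar f k V a c (x, y)" if "(x, y) \<noteq> 0" for x y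
  proof (cases "x = 0")
    case False
    then show ?thesis
      using Vpos[OF False] nn(1)[of "(x, y)"] nn(2)[of "y - k x"] by (simp add: V_bar_def)
  next
    case True
    then have "0 < a (norm (y - k x))"
      using that k0 by (intro K_infinity_pos[OF a]) (auto simp: zero_prod_def)
    then show ?thesis
      using Vnn[of x] nn(1)[of "(x, y)"] by (simp add: V_bar_def)
  qed
  have zero: "V_bar f k V a c 0 = 0"
    using f0 k0 V0 K_infinityD(5)[OF a] by (simp add: V_bar_def zero_prod_def)
  have "0 < V_bar f k V a c z" if "z \<noteq> 0" for z
    using pos[of "fst z" "snd z"] that by simp
  then have "0 \<le> V_bar f k V a c z" for z
    using zero by (cases "z = 0") (simp_all add: less_imp_le)
  then show ?thesis
    using zero pos unfolding positive_definite_def by simp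
qed

text \<open>The space of \<open>x\<close> has to satisfy Heine-Borel because the continuous map \<open>k\<close> is bounded on
  compact sets, but in general not on bounded ones.\<close>

lemma radially_unbounded_V_bar:
  fixes f :: "'x::{real_normed_vector, heine_borel} \<times> 'y::real_normed_vector \<Rightarrow> 'x"
    and k :: "'x \<Rightarrow> 'y"
  assumes k: "continuous_on UNIV k" and V: "radially_unbounded V"
    and Vnn: "\<And>x. 0 \<le> V x" and a: "a \<in> K_infinity" and c: "0 \<le> c"
  shows "radially_unbounded (V_bar f k V a c)"
  unfolding radially_unbounded_def
proof (intro allI impI)
  fix M :: real assume "0 \<le> M"
  define S where "S = {x. V x \<le> M}"
  have bS: "bounded S"
    using V \<open>0 \<le> M\<close> by (simp add: S_def radially_unbounded_def)
  then have "compact (k ` closure S)"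
    by (intro compact_continuous_image continuous_on_subset[OF k]) (auto simp: compact_closure)
  then obtain B where "\<forall>v\<in>k ` closure S. norm v \<le> B"
    using compact_imp_bounded bounded_iff by blast
  then have B: "norm (k x) \<le> B" if "x \<in> S" for x
    using that closure_subset by blast
  obtain R where R: "\<And>r. 0 \<le> r \<Longrightarrow> a r \<le> M \<Longrightarrow> r \<le> R"
    using K_infinity_sublevel_bounded[OF a] by blast
  have "(x, y) \<in> S \<times> cball 0 (B + R)" if "V_bar f k V a c (x, y) \<le> M" for x y
  proof -
    have "0 \<le> c * V (f (x, y))" "0 \<le> a (norm (y - k x))"
      using c Vnn K_infinity_nonneg[OF a] by simp_all
    then have "V x \<le> M" "a (norm (y - k x)) \<le> M"
      using that Vnn[of x] by (simp_all add: V_bar_def)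
    then have "x \<in> S" "norm (y - k x) \<le> R"
      using R by (simp_all add: S_def)
    then show ?thesis
      using B[of x] norm_triangle_sub[of y "k x"] by simp
  qed
  then have "{z. V_bar f k V a c z \<le> M} \<subseteq> S \<times> cball 0 (B + R)"
    by auto
  then show "bounded {z. V_bar f k V a c z \<le> M}"
    using bS bounded_Times bounded_cball bounded_subset by metis
qed

lemma V_bar_decay:
  fixes f :: "'x \<times> 'y::real_normed_vector \<Rightarrow> 'x" and k :: "'x \<Rightarrow> 'y"
  assumes decay: "\<And>x. V (f (x, k x)) \<le> lam * V x" and Vnn: "\<And>x. 0 \<le> V x"
    and a: "a \<in> K_infinity" and c: "0 < c" and lam: "0 \<le> lam"
  shows "V_bar f k V a c (f (x, y), k (f (x, y))) \<le> (lam + inverse c) * V_bar f k V a c (x, y)"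
proof -
  let ?w = "f (x, y)"
  have "V_bar f k V a c (?w, k ?w) = V ?w + c * V (f (?w, k ?w))"
    by (simp add: V_bar_def K_infinityD(5)[OF a])
  also have "\<dots> \<le> V ?w + c * (lam * V ?w)"
    using decay[of ?w] c by (simp add: mult_left_mono)
  also have "\<dots> = (lam + inverse c) * (c * V ?w)"
    using c by (simp add: field_simps)
  also have "\<dots> \<le> (lam + inverse c) * V_bar f k V a c (x, y)"
    using c lam Vnn[of x] K_infinity_nonneg[OF a, of "norm (y - k x)"]
    by (intro mult_left_mono) (simp_all add: V_bar_def)
  finally show ?thesis .
qed

theorem lemma2p1:
  fixes f :: "(real ^ 'n) \<times> (real ^ 'm) \<Rightarrow> real ^ 'n"
    and k :: "real ^ 'n \<Rightarrow> real ^ 'm"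
    and V :: "real ^ 'n \<Rightarrow> real"
    and lam :: real
  assumes "continuous_on UNIV f" and "f (0, 0) = 0"
    and "continuous_on UNIV k" and "k 0 = 0"
    and "globally_asymptotically_stable (\<lambda>x. f (x, k x))"
    and "continuous_on UNIV V" and "positive_definite V" and "radially_unbounded V"
    and "0 \<le> lam" and "lam < 1"
    and "\<forall>x. V (f (x, k x)) \<le> lam * V x"
  shows "globally_asymptotically_stable (closed_loop f k) \<and>
    (\<forall>a\<in>K_infinity. \<forall>c::real. c > 1 / (1 - lam) \<longrightarrow>
       continuous_on UNIV (V_bar f k V a c) \<and>
       positive_definite (V_bar f k V a c) \<and>
       radially_unbounded (V_bar f k V a c) \<and>
       (\<forall>x y. V_bar f k V a c (f (x, y), k (f (x, y))) \<le> (lam + inverse c) * V_bar f k V a c (x, y)))"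
proof (intro conjI ballI allI impI)
  have Vnn: "0 \<le> V x" for x
    using assms(7) by (simp add: positive_definite_def)
  have f0: "f 0 = 0"
    using assms(2) by (simp add: zero_prod_def)
  show "globally_asymptotically_stable (closed_loop f k)"
    using assms(1,3)
    by (intro globally_asymptotically_stable_closed_loop f0 assms(4,5))
      (simp_all add: continuous_on_eq_continuous_at[OF open_UNIV] del: split_paired_All)
  fix a :: "real \<Rightarrow> real" and c :: real
  assume a: "a \<in> K_infinity" and "c > 1 / (1 - lam)"
  moreover have "0 < 1 / (1 - lam)" using assms(10) by simp
  ultimately have c: "0 < c" by linarith
  show "continuous_on UNIV (V_bar f k V a c)"
    by (rule continuous_on_V_bar[OF assms(1,3,6) a])
  show "positive_definite (V_bar f k V a c)"
    using c by (intro positive_definite_V_bar f0 assms(4,7) a) simp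
  show "radially_unbounded (V_bar f k V a c)"
    using c by (intro radially_unbounded_V_bar assms(3,8) Vnn a) simp
  show "V_bar f k V a c (f (x, y), k (f (x, y))) \<le> (lam + inverse c) * V_bar f k V a c (x, y)" for x y
    using assms(11) by (intro V_bar_decay Vnn a c assms(9)) simp
qed

end
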